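(* Let $\kappa$ be a regular uncountable cardinal. If $\mathrm{P}\ell_1(\kappa)$ holds, then for every positive integer $n$ there exists a poset $\mathbb P$ such that $\mathbb P^n$ satisfies the $\kappa$-cc, but $\mathbb P^{n+1}$ does not.
   Context: $[\kappa]^2:=\{(\alpha,\beta)\mid \alpha<\beta<\kappa\}$. For sets of ordinals $a,b$, write $a<b$ iff $\alpha<\beta$ for all $\alpha\in a$ and $\beta\in b$. $\mathrm{P}\ell_1(\kappa)$ asserts the existence of a transformation $\mathbf t:[\kappa]^2\rightarrow[\kappa]^2$ satisfying the following: - for every $(\alpha,\beta)\in[\kappa]^2$, if $\mathbf t(\alpha,\beta)=(\alpha^*,\beta^* )$, then $\alpha^*\le\alpha<\beta^*\le\beta$; - for every family $\mathcal A$ consisting of $\kappa$ many pairwise disjoint finite subsets of $\kappa$, there exists a stationary $S\subseteq\kappa$ such that, for every pair $\alpha^*<\beta^*$ of elements of $S$, there exists a pair $a<b$ of elements of $\mathcal A$ with $\mathbf t[a\times b]=\{(\alpha^*,\beta^* )\}$. $\mathbb P^n$ is the $n$-fold product of $\mathbb P$ with the coordinatewise ordering. A poset satisfies the $\kappa$-cc iff it has no antichain (set of pairwise incompatible elements, i.e., no two of which have a common lower bound) of size $\kappa$. *)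

theory Defs
  imports Main "HOL-Library.FuncSet"
begin

unbundle cardinal_syntax

text \<open>
  A cardinal is a relation \<open>\<kappa>\<close> with \<open>Card_order \<kappa>\<close>, that is, a well-order of minimal order type
  among the well-orders of its field. The elements of \<open>Field \<kappa>\<close> play the role of the ordinals
  below \<open>\<kappa>\<close>, and \<open>(\<alpha>, \<beta>) \<in> \<kappa>\<close> is the non-strict order between them.
\<close>

definition ord_less :: "'a rel \<Rightarrow> 'a \<Rightarrow> 'a \<Rightarrow> bool" where
  "ord_less \<kappa> \<alpha> \<beta> \<longleftrightarrow> (\<alpha>, \<beta>) \<in> \<kappa> \<and> \<alpha> \<noteq> \<beta>"

definition ord_set_less :: "'a rel \<Rightarrow> 'a set \<Rightarrow> 'a set \<Rightarrow> bool" where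
  "ord_set_less \<kappa> a b \<longleftrightarrow> (\<forall>\<alpha>\<in>a. \<forall>\<beta>\<in>b. ord_less \<kappa> \<alpha> \<beta>)"

definition ord_pairs :: "'a rel \<Rightarrow> ('a \<times> 'a) set" where
  "ord_pairs \<kappa> = {(\<alpha>, \<beta>). ord_less \<kappa> \<alpha> \<beta>}"

text \<open>
  In \<open>club_in\<close>, the premise of the closure condition says that \<open>C \<inter> \<delta>\<close> is unbounded in the nonzero
  ordinal \<open>\<delta>\<close>; as the inequalities are strict, such a \<open>\<delta>\<close> is automatically a limit.
\<close>

definition club_in :: "'a rel \<Rightarrow> 'a set \<Rightarrow> bool" where
  "club_in \<kappa> C \<longleftrightarrow> C \<subseteq> Field \<kappa> \<and> cofinal C \<kappa> \<and>
     (\<forall>\<delta>\<in>Field \<kappa>.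
        (\<exists>\<alpha>. ord_less \<kappa> \<alpha> \<delta>) \<and>
        (\<forall>\<alpha>. ord_less \<kappa> \<alpha> \<delta> \<longrightarrow> (\<exists>\<gamma>\<in>C. ord_less \<kappa> \<alpha> \<gamma> \<and> ord_less \<kappa> \<gamma> \<delta>))
        \<longrightarrow> \<delta> \<in> C)"

definition stationary_in :: "'a rel \<Rightarrow> 'a set \<Rightarrow> bool" where
  "stationary_in \<kappa> S \<longleftrightarrow> S \<subseteq> Field \<kappa> \<and> (\<forall>C. club_in \<kappa> C \<longrightarrow> S \<inter> C \<noteq> {})"

definition Pl1 :: "'a rel \<Rightarrow> bool" where
  "Pl1 \<kappa> \<longleftrightarrow> (\<exists>t \<in> ord_pairs \<kappa> \<rightarrow> ord_pairs \<kappa>.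
     (\<forall>(\<alpha>, \<beta>) \<in> ord_pairs \<kappa>. \<forall>\<alpha>' \<beta>'. t (\<alpha>, \<beta>) = (\<alpha>', \<beta>') \<longrightarrow>
        (\<alpha>', \<alpha>) \<in> \<kappa> \<and> ord_less \<kappa> \<alpha> \<beta>' \<and> (\<beta>', \<beta>) \<in> \<kappa>) \<and>
     (\<forall>A. |A| =o \<kappa> \<and> (\<forall>a\<in>A. finite a \<and> a \<subseteq> Field \<kappa>) \<and> pairwise disjnt A \<longrightarrow>
        (\<exists>S. stationary_in \<kappa> S \<and>
           (\<forall>\<alpha>'\<in>S. \<forall>\<beta>'\<in>S. ord_less \<kappa> \<alpha>' \<beta>' \<longrightarrow>
              (\<exists>a\<in>A. \<exists>b\<in>A. ord_set_less \<kappa> a b \<and> t ` (a \<times> b) = {(\<alpha>', \<beta>')})))))"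

text \<open>A poset is given by its underlying set \<open>P\<close> and its order \<open>R\<close>, with \<open>partial_order_on P R\<close>;
  \<open>(p, q) \<in> R\<close> means \<open>p \<le> q\<close>.\<close>

definition compatible_in :: "'p set \<Rightarrow> 'p rel \<Rightarrow> 'p \<Rightarrow> 'p \<Rightarrow> bool" where
  "compatible_in P R p q \<longleftrightarrow> (\<exists>r\<in>P. (r, p) \<in> R \<and> (r, q) \<in> R)"

definition antichain_in :: "'p set \<Rightarrow> 'p rel \<Rightarrow> 'p set \<Rightarrow> bool" where
  "antichain_in P R X \<longleftrightarrow> X \<subseteq> P \<and> pairwise (\<lambda>p q. \<not> compatible_in P R p q) X"

definition chain_cond :: "'a rel \<Rightarrow> 'p set \<Rightarrow> 'p rel \<Rightarrow> bool" where
  "chain_cond \<kappa> P R \<longleftrightarrow> \<not> (\<exists>X. antichain_in P R X \<and> |X| =o \<kappa>)"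

definition pow_set :: "nat \<Rightarrow> 'p set \<Rightarrow> (nat \<Rightarrow> 'p) set" where
  "pow_set n P = {..<n} \<rightarrow>\<^sub>E P"

definition pow_rel :: "nat \<Rightarrow> 'p set \<Rightarrow> 'p rel \<Rightarrow> (nat \<Rightarrow> 'p) rel" where
  "pow_rel n P R = {(f, g). f \<in> pow_set n P \<and> g \<in> pow_set n P \<and> (\<forall>i<n. (f i, g i) \<in> R)}"

end

theory Submission
  imports Defs
begin

text \<open>
  Iterating the transformation \<open>t\<close> at a pair never increases either coordinate, so it reaches a
  fixed point after finitely many steps; let \<open>N\<close> count them. Colouring pairs by \<open>N\<close> modulo
  \<open>n + 1\<close> is a strong colouring: every family of \<open>\<kappa>\<close> many pairwise disjoint finite sets contains
  \<open>a < b\<close> with \<open>a \<times> b\<close> monochromatic of any prescribed colour. Indeed, the family yields a set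
  \<open>T\<^sub>0\<close> all of whose pairs are values of \<open>t\<close> on some \<open>a \<times> b\<close>, and inductively \<open>T\<^sub>i\<close> yields a set
  \<open>T\<^sub>i\<^sub>+\<^sub>1\<close> whose pairs are values of \<open>t\<close> on pairs from \<open>T\<^sub>i\<close>. Applying the hypothesis to finite sets
  meeting all of \<open>T\<^sub>0, \<dots>, T\<^sub>n\<close>, some count \<open>v\<close> occurs in every \<open>T\<^sub>i\<close>; pushing it down to \<open>T\<^sub>0\<close>
  gives the counts \<open>v, \<dots>, v + n\<close> there. The poset is the disjoint sum over the colours \<open>i \<le> n\<close> of the
  posets of finite sets omitting the colour \<open>i\<close>: its \<open>n\<close>-th power involves at most \<open>n\<close> of the
  colours in each condition, leaving one along which a \<open>\<Delta>\<close>-system amalgamates, whereas the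
  diagonal of the \<open>n + 1\<close> summands is an antichain.
\<close>

section \<open>Residues, and step counts of an iterated map\<close>

lemma mod_shift_exists: "\<exists>i\<le>n. (v + i) mod (n + 1) = j" if "j \<le> n" for v n j :: nat
proof -
  \<comment> \<open>This is \<open>j - v\<close> modulo \<open>n + 1\<close>; the summand
    \<open>(n + 1) * v\<close> keeps the subtraction of naturals from truncating.\<close>
  define i where "i = (j + (n + 1) * v - v) mod (n + 1)"
  have "(v + i) mod (n + 1) = (v + (j + (n + 1) * v - v)) mod (n + 1)"
    unfolding i_def by (rule mod_add_right_eq)
  also have "v + (j + (n + 1) * v - v) = j + (n + 1) * v"
    by (simp add: algebra_simps)
  also have "\<dots> mod (n + 1) = j mod (n + 1)"
    by (rule mod_mult_self2)
  also have "\<dots> = j"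
    using that by simp
  finally have "(v + i) mod (n + 1) = j" .
  moreover have "i \<le> n"
    unfolding i_def using mod_less_divisor[of "n + 1" "j + (n + 1) * v - v"] by simp
  ultimately show ?thesis
    by blast
qed

text \<open>\<open>LEAST\<close> is meaningful only where the orbit stabilises; on
  \<open>ord_pairs \<kappa>\<close> this is secured by \<open>t_stabilises\<close>.\<close>

definition steps :: "('b \<Rightarrow> 'b) \<Rightarrow> 'b \<Rightarrow> nat" where
  "steps t p = (LEAST k. (t ^^ Suc k) p = (t ^^ k) p)"

lemma steps_Suc:
  assumes "t p \<noteq> p" and "(t ^^ Suc k) p = (t ^^ k) p"
  shows "steps t p = Suc (steps t (t p))"
proof -
  have "steps t p = Suc (LEAST k. (t ^^ Suc (Suc k)) p = (t ^^ Suc k) p)"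
    unfolding steps_def
    by (rule Least_Suc[where P = "\<lambda>k. (t ^^ Suc k) p = (t ^^ k) p", OF assms(2)]) (simp add: assms(1))
  then show ?thesis
    by (simp add: steps_def funpow_swap1)
qed

section \<open>Small sets (\<open><o \<kappa>\<close>) and large sets
  (\<open>=o \<kappa>\<close>)\<close>

locale regular_uncountable =
  fixes \<kappa> :: "'a rel"
  assumes card_order: "Card_order \<kappa>" and uncountable: "natLeq <o \<kappa>" and regular: "regularCard \<kappa>"
begin

lemma well_order: "Well_order \<kappa>"
  using card_order by (rule card_order_on_well_order_on)

lemma card_Field: "|Field \<kappa>| =o \<kappa>"
  using card_order by (rule card_of_Field_ordIso)

lemma infinite_Field: "infinite (Field \<kappa>)"
  using ordLeq_ordIso_trans[OF ordLess_imp_ordLeq[OF uncountable] ordIso_symmetric[OF card_Field]]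
    infinite_iff_natLeq_ordLeq[of "Field \<kappa>"]
  by simp

lemma finite_small: "finite X \<Longrightarrow> |X| <o \<kappa>"
  using finite_ordLess_infinite[OF card_of_Well_order well_order] infinite_Field
  by (simp add: Field_card_of)

lemma small_not_large: "|X| <o \<kappa> \<Longrightarrow> \<not> |X| =o \<kappa>"
  by (rule not_ordLess_ordIso)

lemma large_infinite: "|X| =o \<kappa> \<Longrightarrow> infinite X"
  by (rule notI) (use finite_small[of X] small_not_large[of X] in simp)

lemma not_large_small:
  assumes "|Y| =o \<kappa>" and "X \<subseteq> Y" and "\<not> |X| =o \<kappa>"
  shows "|X| <o \<kappa>"
  using ordLeq_ordIso_trans[OF card_of_mono1[OF assms(2)] assms(1)] assms(3)
  unfolding ordLeq_iff_ordLess_or_ordIso by simp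

text \<open>Regularity of \<kappa> enters the counting arguments through this bound.\<close>

lemma small_UN: "|I| <o \<kappa> \<Longrightarrow> (\<And>i. i \<in> I \<Longrightarrow> |A i| <o \<kappa>) \<Longrightarrow> |\<Union>i\<in>I. A i| <o \<kappa>"
  using card_of_UNION_ordLess_infinite_Field_regularCard[OF regular, of I A] infinite_Field card_order
  by (simp add: cinfinite_def)

lemma small_mono: "|Y| <o \<kappa> \<Longrightarrow> X \<subseteq> Y \<Longrightarrow> |X| <o \<kappa>"
  by (rule ordLeq_ordLess_trans[OF card_of_mono1])

lemma large_pigeonhole:
  assumes "|X| =o \<kappa>" and "|f ` X| <o \<kappa>"
  obtains y where "|{x\<in>X. f x = y}| =o \<kappa>"
proof (rule ccontr)
  assume "\<not> thesis"
  then have "|{x\<in>X. f x = y}| <o \<kappa>" for y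
    by (intro not_large_small[OF assms(1)]) (auto intro: that)
  then have "|\<Union>y\<in>f ` X. {x\<in>X. f x = y}| <o \<kappa>"
    by (intro small_UN assms(2))
  moreover have "(\<Union>y\<in>f ` X. {x\<in>X. f x = y}) = X"
    by auto
  ultimately show False
    using assms(1) small_not_large[of X] by simp
qed

text \<open>Uncountability of \<kappa>, in the form that lets \<open>delta_system\<close> apply the
  pigeonhole to cardinalities of finite sets.\<close>

lemma small_nat: "|X :: nat set| <o \<kappa>"
proof -
  have "|X| \<le>o |UNIV :: nat set|"
    by (rule card_of_mono1) simp
  then show ?thesis
    by (rule ordLeq_ordLess_trans[OF ordLeq_ordIso_trans[OF _ card_of_nat] uncountable])
qed

lemma large_bij_image: "|X| =o \<kappa> \<Longrightarrow> inj_on f X \<Longrightarrow> |f ` X| =o \<kappa>"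
  using ordIso_transitive[OF ordIso_symmetric[OF card_of_ordIsoI[OF inj_on_imp_bij_betw]]] by blast

lemma large_bij:
  assumes "|X| =o \<kappa>" "|Y| =o \<kappa>"
  obtains h where "bij_betw h X Y"
  using ordIso_transitive[OF assms(1) ordIso_symmetric[OF assms(2)]] that
  unfolding card_of_ordIso[symmetric] by blast

lemma large_Diff_finite:
  assumes "|X| =o \<kappa>" "finite E"
  shows "|X - E| =o \<kappa>"
proof (rule ccontr)
  assume "\<not> ?thesis"
  then have "|X - E| <o \<kappa>"
    by (rule not_large_small[OF assms(1) Diff_subset])
  \<comment> \<open>The union of \<open>X - E\<close> and \<open>E\<close> is indexed by
    \<open>bool\<close> so that \<open>small_UN\<close> applies.\<close>
  then have "|\<Union>b\<in>UNIV. if b then X - E else E| <o \<kappa>"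
    using finite_small[OF assms(2)] finite_small[of "UNIV :: bool set"] by (intro small_UN) auto
  then have "|X| <o \<kappa>"
    by (rule small_mono) (auto simp: UNIV_bool)
  then show False
    using small_not_large[of X] assms(1) by simp
qed

section \<open>Disjoint refinements and Delta-systems\<close>

text \<open>Zorn gives a maximal disjoint subfamily \<open>Y\<close>. Were it small, its union would
  be small too; by maximality every \<open>F x\<close> meets that union, so \<open>X\<close> would
  be a small union of small sets.\<close>

lemma disjoint_refinement:
  assumes X: "|X| =o \<kappa>" and fin: "\<And>x. x \<in> X \<Longrightarrow> finite (F x) \<and> F x \<noteq> {}"
    and small: "\<And>p. |{x\<in>X. p \<in> F x}| <o \<kappa>"
  obtains Y where "Y \<subseteq> X" "|Y| =o \<kappa>" "\<forall>x\<in>Y. \<forall>y\<in>Y. x \<noteq> y \<longrightarrow> F x \<inter> F y = {}"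
proof -
  define D where "D = {Y. Y \<subseteq> X \<and> (\<forall>x\<in>Y. \<forall>y\<in>Y. x \<noteq> y \<longrightarrow> F x \<inter> F y = {})}"
  have "\<Union>C \<in> D" if C: "subset.chain D C" for C
  proof -
    have "F x \<inter> F y = {}" if xy: "x \<in> U" "y \<in> V" "U \<in> C" "V \<in> C" "x \<noteq> y" for x y U V
    proof -
      have "U \<subseteq> V \<or> V \<subseteq> U" "U \<in> D" "V \<in> D"
        using C xy(3,4) unfolding subset_chain_def by blast+
      then obtain W where "W \<in> D" "x \<in> W" "y \<in> W"
        using xy(1,2) by blast
      then show ?thesis
        using xy(5) unfolding D_def by blast
    qed
    moreover have "\<Union>C \<subseteq> X"
      using C unfolding subset_chain_def D_def by blast
    ultimately show ?thesis
      unfolding D_def by blast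
  qed
  from subset_Zorn'[OF this] obtain Y where Y: "Y \<in> D" and max: "\<And>Z. Z \<in> D \<Longrightarrow> Y \<subseteq> Z \<Longrightarrow> Z = Y"
    by blast
  have YX: "Y \<subseteq> X"
    using Y unfolding D_def by blast
  have "|Y| =o \<kappa>"
  proof (rule ccontr)
    assume "\<not> |Y| =o \<kappa>"
    then have "|Y| <o \<kappa>"
      by (rule not_large_small[OF X YX])
    then have "|\<Union>y\<in>Y. F y| <o \<kappa>"
      by (rule small_UN) (use fin YX finite_small in blast)
    then have "|\<Union>p\<in>(\<Union>y\<in>Y. F y). {x\<in>X. p \<in> F x}| <o \<kappa>"
      by (rule small_UN) (rule small)
    moreover have "X \<subseteq> (\<Union>p\<in>(\<Union>y\<in>Y. F y). {x\<in>X. p \<in> F x})"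
    proof
      fix x assume x: "x \<in> X"
      show "x \<in> (\<Union>p\<in>(\<Union>y\<in>Y. F y). {x\<in>X. p \<in> F x})"
      proof (rule ccontr)
        assume *: "\<not> ?thesis"
        then have disj: "F x \<inter> F y = {}" if "y \<in> Y" for y
          using x that by blast
        then have "insert x Y \<in> D"
          using x YX Y unfolding D_def by (auto simp: Int_commute)
        \<comment> \<open>Now \<open>F x\<close> is disjoint from itself, yet nonempty.\<close>
        then have "x \<in> Y"
          using max by blast
        then show False
          using disj fin x by blast
      qed
    qed
    ultimately have "|X| <o \<kappa>"
      by (rule small_mono)
    then show False
      using small_not_large[of X] X by simp
  qed
  then show thesis
    by (rule that[OF YX]) (use Y in \<open>auto simp: D_def\<close>)
qed

text \<open>Induction on the common size: a point lying in \<kappa> many \<open>F x\<close> is moved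
  into the root; if there is none, \<open>disjoint_refinement\<close> applies with empty root.
  Intersections are only required to lie inside \<open>r\<close>, since \<open>pow_cc\<close> later
  makes the traces on the root equal by pigeonhole.\<close>

lemma delta_system_card:
  assumes "|X| =o \<kappa>" and "\<And>x. x \<in> X \<Longrightarrow> finite (F x) \<and> card (F x) = m"
  shows "\<exists>Y r. Y \<subseteq> X \<and> |Y| =o \<kappa> \<and> finite r \<and> (\<forall>x\<in>Y. \<forall>y\<in>Y. x \<noteq> y \<longrightarrow> F x \<inter> F y \<subseteq> r)"
  using assms
proof (induction m arbitrary: X F)
  case 0
  have "F x = {}" if "x \<in> X" for x
    using 0(2)[OF that] card_0_eq by blast
  then show ?case
    using 0(1) by (intro exI[of _ X] exI[of _ "{}"]) auto
next
  case (Suc m)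
  show ?case
  proof (cases "\<exists>p. |{x\<in>X. p \<in> F x}| =o \<kappa>")
    case True
    then obtain p where p: "|{x\<in>X. p \<in> F x}| =o \<kappa>"
      by blast
    obtain Y r where Y: "Y \<subseteq> {x\<in>X. p \<in> F x}" "|Y| =o \<kappa>" "finite r"
        "\<forall>x\<in>Y. \<forall>y\<in>Y. x \<noteq> y \<longrightarrow> (F x - {p}) \<inter> (F y - {p}) \<subseteq> r"
      using Suc.IH[OF p, of "\<lambda>x. F x - {p}"] Suc.prems(2) by force
    then show ?thesis
      by (intro exI[of _ Y] exI[of _ "insert p r"]) blast
  next
    case False
    then have "|{x\<in>X. p \<in> F x}| <o \<kappa>" for p
      by (intro not_large_small[OF Suc.prems(1)]) auto
    moreover have "finite (F x) \<and> F x \<noteq> {}" if "x \<in> X" for x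
      using Suc.prems(2)[OF that] by auto
    ultimately obtain Y where "Y \<subseteq> X" "|Y| =o \<kappa>"
        "\<forall>x\<in>Y. \<forall>y\<in>Y. x \<noteq> y \<longrightarrow> F x \<inter> F y = {}"
      using disjoint_refinement[OF Suc.prems(1), of F] by blast
    then show ?thesis
      by (intro exI[of _ Y] exI[of _ "{}"]) auto
  qed
qed

lemma delta_system:
  assumes "|X| =o \<kappa>" and "\<And>x. x \<in> X \<Longrightarrow> finite (F x)"
  obtains Y r where "Y \<subseteq> X" "|Y| =o \<kappa>" "finite r"
    "\<forall>x\<in>Y. \<forall>y\<in>Y. x \<noteq> y \<longrightarrow> F x \<inter> F y \<subseteq> r"
proof -
  obtain m where m: "|{x\<in>X. card (F x) = m}| =o \<kappa>"
    using large_pigeonhole[OF assms(1), of "\<lambda>x. card (F x)"] small_nat by metis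
  obtain Y r where "Y \<subseteq> {x\<in>X. card (F x) = m}" "|Y| =o \<kappa>" "finite r"
      "\<forall>x\<in>Y. \<forall>y\<in>Y. x \<noteq> y \<longrightarrow> F x \<inter> F y \<subseteq> r"
    using delta_system_card[OF m, of F m] assms(2) by force
  then show thesis
    by (intro that[of Y r]) auto
qed

section \<open>The order of \<kappa>, its tails and stationary sets\<close>

lemma ord_less_total: "\<alpha> \<in> Field \<kappa> \<Longrightarrow> \<beta> \<in> Field \<kappa> \<Longrightarrow> \<alpha> \<noteq> \<beta> \<Longrightarrow> ord_less \<kappa> \<alpha> \<beta> \<or> ord_less \<kappa> \<beta> \<alpha>"
  using well_order unfolding order_on_defs total_on_def ord_less_def by blast

lemma ord_less_asym: "ord_less \<kappa> \<alpha> \<beta> \<Longrightarrow> \<not> ord_less \<kappa> \<beta> \<alpha>"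
  using well_order unfolding order_on_defs antisym_def ord_less_def by blast

lemma ord_less_trans: "ord_less \<kappa> \<alpha> \<beta> \<Longrightarrow> ord_less \<kappa> \<beta> \<gamma> \<Longrightarrow> ord_less \<kappa> \<alpha> \<gamma>"
  using well_order unfolding order_on_defs antisym_def trans_def ord_less_def by blast

lemma ord_less_Field: "ord_less \<kappa> \<alpha> \<beta> \<Longrightarrow> \<alpha> \<in> Field \<kappa> \<and> \<beta> \<in> Field \<kappa>"
  unfolding ord_less_def by (auto intro: FieldI1 FieldI2)

lemma ord_less_unbounded: "\<alpha> \<in> Field \<kappa> \<Longrightarrow> \<exists>\<beta>. ord_less \<kappa> \<alpha> \<beta>"
  using infinite_Card_order_limit[OF card_order infinite_Field] unfolding ord_less_def by blast

text \<open>A stationary set meets every tail, so it is cofinal, and regularity then makes it large;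
  see \<open>stationary_large\<close>.\<close>

lemma club_tail:
  assumes "\<alpha> \<in> Field \<kappa>"
  shows "club_in \<kappa> {\<beta>. ord_less \<kappa> \<alpha> \<beta>}"
  unfolding club_in_def
proof (intro conjI ballI impI)
  show "{\<beta>. ord_less \<kappa> \<alpha> \<beta>} \<subseteq> Field \<kappa>"
    using ord_less_Field by blast
  show "cofinal {\<beta>. ord_less \<kappa> \<alpha> \<beta>} \<kappa>"
    unfolding cofinal_def
  proof
    fix \<gamma> assume \<gamma>: "\<gamma> \<in> Field \<kappa>"
    obtain \<delta> where \<delta>: "ord_less \<kappa> \<gamma> \<delta>"
      using ord_less_unbounded[OF \<gamma>] by blast
    obtain \<epsilon> where \<epsilon>: "ord_less \<kappa> \<alpha> \<epsilon>"
      using ord_less_unbounded[OF assms] by blast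
    have "\<delta> = \<epsilon> \<or> ord_less \<kappa> \<delta> \<epsilon> \<or> ord_less \<kappa> \<epsilon> \<delta>"
      using ord_less_total ord_less_Field \<delta> \<epsilon> by blast
    then have "\<exists>\<beta>. ord_less \<kappa> \<alpha> \<beta> \<and> ord_less \<kappa> \<gamma> \<beta>"
      using \<delta> \<epsilon> ord_less_trans by blast
    then show "\<exists>b\<in>{\<beta>. ord_less \<kappa> \<alpha> \<beta>}. \<gamma> \<noteq> b \<and> (\<gamma>, b) \<in> \<kappa>"
      unfolding ord_less_def by blast
  qed
next
  fix \<delta>
  assume "(\<exists>\<beta>. ord_less \<kappa> \<beta> \<delta>) \<and> (\<forall>\<beta>. ord_less \<kappa> \<beta> \<delta> \<longrightarrow>
    (\<exists>\<gamma>\<in>{\<beta>. ord_less \<kappa> \<alpha> \<beta>}. ord_less \<kappa> \<beta> \<gamma> \<and> ord_less \<kappa> \<gamma> \<delta>))"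
  then show "\<delta> \<in> {\<beta>. ord_less \<kappa> \<alpha> \<beta>}"
    using ord_less_trans by blast
qed

lemma stationary_large:
  assumes "stationary_in \<kappa> S"
  shows "|S| =o \<kappa>"
proof -
  have "\<exists>\<beta>\<in>S. ord_less \<kappa> \<alpha> \<beta>" if "\<alpha> \<in> Field \<kappa>" for \<alpha>
    using assms club_tail[OF that] unfolding stationary_in_def by blast
  then have "cofinal S \<kappa>"
    unfolding cofinal_def ord_less_def by blast
  then show ?thesis
    using regular assms unfolding regularCard_def stationary_in_def by blast
qed

definition pairs_in :: "'a set \<Rightarrow> ('a \<times> 'a) set" where
  "pairs_in S = ord_pairs \<kappa> \<inter> S \<times> S"

lemma pairs_in_nonempty:
  assumes "S \<subseteq> Field \<kappa>" "|S| =o \<kappa>"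
  shows "\<exists>p. p \<in> pairs_in S"
proof -
  obtain \<alpha> where \<alpha>: "\<alpha> \<in> S"
    using large_infinite[OF assms(2)] by fastforce
  obtain \<beta> where "\<beta> \<in> S" "\<beta> \<noteq> \<alpha>"
    using large_infinite[OF assms(2)] finite_subset[of S "{\<alpha>}"] by blast
  then show ?thesis
    using \<alpha> assms(1) ord_less_total[of \<alpha> \<beta>] unfolding pairs_in_def ord_pairs_def by blast
qed

end

section \<open>Families of finite sets under the transformation\<close>

locale transformation = regular_uncountable +
  fixes t :: "'a \<times> 'a \<Rightarrow> 'a \<times> 'a"
  assumes t_pairs: "p \<in> ord_pairs \<kappa> \<Longrightarrow> t p \<in> ord_pairs \<kappa>"
    and t_fst: "(\<alpha>, \<beta>) \<in> ord_pairs \<kappa> \<Longrightarrow> (fst (t (\<alpha>, \<beta>)), \<alpha>) \<in> \<kappa>"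
    and t_snd: "(\<alpha>, \<beta>) \<in> ord_pairs \<kappa> \<Longrightarrow> (snd (t (\<alpha>, \<beta>)), \<beta>) \<in> \<kappa>"
    and t_stationary: "|A| =o \<kappa> \<Longrightarrow> (\<And>a. a \<in> A \<Longrightarrow> finite a \<and> a \<subseteq> Field \<kappa>) \<Longrightarrow> pairwise disjnt A \<Longrightarrow>
      \<exists>S. stationary_in \<kappa> S \<and> (\<forall>\<alpha>\<in>S. \<forall>\<beta>\<in>S. ord_less \<kappa> \<alpha> \<beta> \<longrightarrow>
              (\<exists>a\<in>A. \<exists>b\<in>A. ord_set_less \<kappa> a b \<and> t ` (a \<times> b) = {(\<alpha>, \<beta>)}))"
begin

text \<open>Stationarity is weakened to size \<kappa>, so that the set obtained can itself supply
  the next family of finite sets.\<close>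

lemma t_family:
  assumes "|A| =o \<kappa>" "\<And>a. a \<in> A \<Longrightarrow> finite a \<and> a \<subseteq> Field \<kappa>" "pairwise disjnt A"
  obtains S where "S \<subseteq> Field \<kappa>" "|S| =o \<kappa>"
    "\<forall>p\<in>pairs_in S. \<exists>a\<in>A. \<exists>b\<in>A. ord_set_less \<kappa> a b \<and> t ` (a \<times> b) = {p}"
proof -
  obtain S where S: "stationary_in \<kappa> S" "\<And>\<alpha> \<beta>. \<alpha> \<in> S \<Longrightarrow> \<beta> \<in> S \<Longrightarrow> ord_less \<kappa> \<alpha> \<beta> \<Longrightarrow>
              (\<exists>a\<in>A. \<exists>b\<in>A. ord_set_less \<kappa> a b \<and> t ` (a \<times> b) = {(\<alpha>, \<beta>)})"
    using t_stationary[OF assms] by metis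
  show thesis
  proof (rule that)
    show "S \<subseteq> Field \<kappa>"
      using S(1) unfolding stationary_in_def by blast
    show "|S| =o \<kappa>"
      using S(1) by (rule stationary_large)
    show "\<forall>p\<in>pairs_in S. \<exists>a\<in>A. \<exists>b\<in>A. ord_set_less \<kappa> a b \<and> t ` (a \<times> b) = {p}"
      using S(2) unfolding pairs_in_def ord_pairs_def by auto
  qed
qed

lemma t_indexed:
  assumes I: "|I| =o \<kappa>" and F: "\<And>x. x \<in> I \<Longrightarrow> finite (F x) \<and> F x \<subseteq> Field \<kappa> \<and> F x \<noteq> {}"
    and disj: "\<forall>x\<in>I. \<forall>y\<in>I. x \<noteq> y \<longrightarrow> F x \<inter> F y = {}"
  obtains S where "S \<subseteq> Field \<kappa>" "|S| =o \<kappa>"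
    "\<forall>p\<in>pairs_in S. \<exists>x\<in>I. \<exists>y\<in>I. ord_set_less \<kappa> (F x) (F y) \<and> t ` (F x \<times> F y) = {p}"
proof -
  have "inj_on F I"
    using F disj by (intro inj_onI) (metis Int_absorb)
  then have "|F ` I| =o \<kappa>"
    using I by (simp add: large_bij_image)
  moreover have "finite a \<and> a \<subseteq> Field \<kappa>" if "a \<in> F ` I" for a
    using F that by blast
  moreover have "pairwise disjnt (F ` I)"
    using disj by (simp add: pairwise_image pairwise_def disjnt_def) metis
  ultimately obtain S where "S \<subseteq> Field \<kappa>" "|S| =o \<kappa>"
    "\<forall>p\<in>pairs_in S. \<exists>a\<in>F ` I. \<exists>b\<in>F ` I. ord_set_less \<kappa> a b \<and> t ` (a \<times> b) = {p}"
    by (rule t_family)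
  then show thesis
    by (intro that[of S]) auto
qed

lemma t_predecessors:
  assumes "T \<subseteq> Field \<kappa>" "|T| =o \<kappa>"
  obtains S where "S \<subseteq> Field \<kappa>" "|S| =o \<kappa>" "\<forall>p\<in>pairs_in S. \<exists>q\<in>pairs_in T. t q = p"
proof -
  obtain S where S: "S \<subseteq> Field \<kappa>" "|S| =o \<kappa>" "\<forall>p\<in>pairs_in S.
      \<exists>x\<in>T. \<exists>y\<in>T. ord_set_less \<kappa> {x} {y} \<and> t ` ({x} \<times> {y}) = {p}"
    by (rule t_indexed[OF assms(2), of "\<lambda>x. {x}"]) (use assms(1) in auto)
  show thesis
  proof (rule that[OF S(1,2)], intro ballI)
    fix p assume "p \<in> pairs_in S"
    from bspec[OF S(3) this] show "\<exists>q\<in>pairs_in T. t q = p"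
      unfolding pairs_in_def ord_pairs_def ord_set_less_def by auto
  qed
qed

text \<open>If \<open>t\<close> is constant on \<open>a \<times> b\<close>, it has at most one fixed point there; so a family of
  two-element subsets of \<open>T\<close> does the job.\<close>

lemma t_not_fixed:
  assumes T: "T \<subseteq> Field \<kappa>" "|T| =o \<kappa>"
  shows "\<exists>p\<in>pairs_in T. t p \<noteq> p"
proof -
  have "|UNIV :: bool set| <o |T|"
    by (rule ordLess_ordIso_trans[OF finite_small ordIso_symmetric[OF T(2)]]) simp
  then have "|T \<times> (UNIV :: bool set)| =o |T|"
    using large_infinite[OF T(2)] by (intro card_of_Times_infinite_simps(1) ordLess_imp_ordLeq) auto
  \<comment> \<open>This bijection splits \<open>T\<close> into the disjoint two-element sets
    \<open>F x\<close>.\<close>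
  then obtain h where h: "bij_betw h (T \<times> (UNIV :: bool set)) T"
    using card_of_ordIso by blast
  define F where "F x = {h (x, True), h (x, False)}" for x
  have hT: "h (x, b) \<in> T" if "x \<in> T" for x b
    using h that bij_betwE by blast
  have inj: "h (x, b) = h (y, c) \<longleftrightarrow> x = y \<and> b = c" if "x \<in> T" "y \<in> T" for x y b c
    using inj_on_eq_iff[OF bij_betw_imp_inj_on[OF h]] that by auto
  obtain S where S: "S \<subseteq> Field \<kappa>" "|S| =o \<kappa>" "\<forall>p\<in>pairs_in S.
      \<exists>x\<in>T. \<exists>y\<in>T. ord_set_less \<kappa> (F x) (F y) \<and> t ` (F x \<times> F y) = {p}"
  proof (rule t_indexed[OF T(2), of F])
    show "finite (F x) \<and> F x \<subseteq> Field \<kappa> \<and> F x \<noteq> {}" if "x \<in> T" for x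
      using hT[OF that] T(1) unfolding F_def by auto
    show "\<forall>x\<in>T. \<forall>y\<in>T. x \<noteq> y \<longrightarrow> F x \<inter> F y = {}"
      unfolding F_def by (auto simp: inj)
  qed blast
  obtain p where "p \<in> pairs_in S"
    using pairs_in_nonempty S by blast
  then obtain x y where xy: "x \<in> T" "y \<in> T" "ord_set_less \<kappa> (F x) (F y)" "t ` (F x \<times> F y) = {p}"
    using S(3) by blast
  define q where "q b = (h (x, b), h (y, True))" for b
  have "q b \<in> pairs_in T" "t (q b) = p" for b
  proof -
    have "q b \<in> F x \<times> F y"
      unfolding q_def F_def by (cases b) auto
    then show "t (q b) = p" "q b \<in> pairs_in T"
      using xy hT unfolding pairs_in_def ord_pairs_def ord_set_less_def by (auto simp: q_def)
  qed
  moreover have "q True \<noteq> q False"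
    using inj xy unfolding q_def by auto
  ultimately show ?thesis
    by metis
qed

text \<open>Let \<open>F x\<close> collect one point \<open>h i x\<close> from each
  \<open>T i\<close>. A point lies in only finitely many \<open>F x\<close>, so \<kappa> many of
  them are disjoint; if \<open>t\<close> is constantly \<open>p\<close> on
  \<open>F x \<times> F y\<close>, then \<open>(h i x, h i y)\<close> is a preimage of
  \<open>p\<close> for every \<open>i\<close>.\<close>

lemma t_common_value:
  fixes n :: nat
  assumes T: "\<And>i. i \<le> n \<Longrightarrow> T i \<subseteq> Field \<kappa> \<and> |T i| =o \<kappa>"
  obtains S where "S \<subseteq> Field \<kappa>" "|S| =o \<kappa>"
    "\<forall>p\<in>pairs_in S. \<forall>i\<le>n. \<exists>q\<in>pairs_in (T i). t q = p"
proof -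
  have "\<exists>h. bij_betw h (Field \<kappa>) (T i)" if "i \<le> n" for i
    using large_bij[OF card_Field] T[OF that] by metis
  then obtain h where h: "\<And>i. i \<le> n \<Longrightarrow> bij_betw (h i) (Field \<kappa>) (T i)"
    by metis
  define F where "F x = (\<lambda>i. h i x) ` {..n}" for x
  have hT: "h i x \<in> T i" if "x \<in> Field \<kappa>" "i \<le> n" for x i
    using h that bij_betwE by blast
  have fin: "finite (F x) \<and> F x \<noteq> {}" for x
    unfolding F_def by simp
  have sub: "F x \<subseteq> Field \<kappa>" if "x \<in> Field \<kappa>" for x
    using hT[OF that] T unfolding F_def by fastforce
  have "finite {x\<in>Field \<kappa>. p \<in> F x}" for p
  proof -
    have "{x\<in>Field \<kappa>. p \<in> F x} \<subseteq> (\<lambda>i. inv_into (Field \<kappa>) (h i) p) ` {..n}"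
    proof
      fix x assume "x \<in> {x\<in>Field \<kappa>. p \<in> F x}"
      then obtain i where i: "x \<in> Field \<kappa>" "i \<le> n" "p = h i x"
        unfolding F_def by blast
      then have "x = inv_into (Field \<kappa>) (h i) p"
        using bij_betw_imp_inj_on[OF h] by (simp add: inv_into_f_f)
      then show "x \<in> (\<lambda>i. inv_into (Field \<kappa>) (h i) p) ` {..n}"
        using i(2) by blast
    qed
    then show ?thesis
      using finite_subset by blast
  qed
  then have small: "|{x \<in> Field \<kappa>. p \<in> F x}| <o \<kappa>" for p
    by (rule finite_small)
  obtain I where I: "I \<subseteq> Field \<kappa>" "|I| =o \<kappa>"
      "\<forall>x\<in>I. \<forall>y\<in>I. x \<noteq> y \<longrightarrow> F x \<inter> F y = {}"
    by (rule disjoint_refinement[OF card_Field fin small])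
  have I_sub: "finite (F x) \<and> F x \<subseteq> Field \<kappa> \<and> F x \<noteq> {}" if "x \<in> I" for x
    using fin sub I(1) that by blast
  obtain S where S: "S \<subseteq> Field \<kappa>" "|S| =o \<kappa>" "\<forall>p\<in>pairs_in S.
      \<exists>x\<in>I. \<exists>y\<in>I. ord_set_less \<kappa> (F x) (F y) \<and> t ` (F x \<times> F y) = {p}"
    by (rule t_indexed[OF I(2) I_sub I(3)])
  show thesis
  proof (rule that[OF S(1,2)], intro ballI allI impI)
    fix p i assume "p \<in> pairs_in S" "i \<le> n"
    then obtain x y where xy: "x \<in> I" "y \<in> I" "ord_set_less \<kappa> (F x) (F y)" "t ` (F x \<times> F y) = {p}"
      using S(3) by blast
    have "(h i x, h i y) \<in> F x \<times> F y"
      using \<open>i \<le> n\<close> unfolding F_def by blast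
    then have "t (h i x, h i y) = p" "(h i x, h i y) \<in> pairs_in (T i)"
      using xy hT I(1) \<open>i \<le> n\<close> unfolding pairs_in_def ord_pairs_def ord_set_less_def by auto
    then show "\<exists>q\<in>pairs_in (T i). t q = p"
      by blast
  qed
qed

section \<open>Step counts and the strong colouring\<close>

text \<open>A pair moved by \<open>t\<close> decreases lexicographically, because neither coordinate
  grows; the lexicographic order is well-founded.\<close>

lemma t_stabilises:
  assumes "p \<in> ord_pairs \<kappa>"
  shows "\<exists>k. (t ^^ Suc k) p = (t ^^ k) p"
proof -
  have "wf ((\<kappa> - Id) <*lex*> (\<kappa> - Id))"
    using well_order unfolding well_order_on_def by blast
  then show ?thesis
    using assms
  proof (induction p rule: wf_induct_rule)
    case (less p)
    show ?case
    proof (cases "t p = p")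
      case True
      then show ?thesis
        by (intro exI[of _ 0]) simp
    next
      case False
      then have "(t p, p) \<in> (\<kappa> - Id) <*lex*> (\<kappa> - Id)"
        using t_fst[of "fst p" "snd p"] t_snd[of "fst p" "snd p"] less.prems
        by (cases p; cases "t p") auto
      then obtain k where "(t ^^ Suc k) (t p) = (t ^^ k) (t p)"
        using less.IH t_pairs less.prems by blast
      then show ?thesis
        by (intro exI[of _ "Suc k"]) (simp add: funpow_swap1)
    qed
  qed
qed

lemma steps_t: "p \<in> ord_pairs \<kappa> \<Longrightarrow> t p \<noteq> p \<Longrightarrow> steps t p = Suc (steps t (t p))"
  using steps_Suc t_stabilises by metis

lemma steps_preimage:
  assumes "p \<in> ord_pairs \<kappa>" "t p = q" "t q \<noteq> q"
  shows "steps t p = Suc (steps t q)"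
  using steps_t[of p] assms by metis

text \<open>The pairs are required not to be fixed because only then does a further preimage have
  exactly one step more.\<close>

lemma consecutive_steps:
  fixes n :: nat
  assumes "T\<^sub>0 \<subseteq> Field \<kappa>" "|T\<^sub>0| =o \<kappa>"
  obtains v where "\<forall>i\<le>n. \<exists>q\<in>pairs_in T\<^sub>0. t q \<noteq> q \<and> steps t q = v + i"
proof -
  define L where "L T \<longleftrightarrow> T \<subseteq> Field \<kappa> \<and> |T| =o \<kappa>" for T
  have "\<exists>S. L S \<and> (\<forall>p\<in>pairs_in S. \<exists>q\<in>pairs_in T. t q = p)" if "L T" for T
    using t_predecessors[of T] that unfolding L_def by metis
  then obtain G where G: "\<And>T. L T \<Longrightarrow> L (G T)"
      "\<And>T p. L T \<Longrightarrow> p \<in> pairs_in (G T) \<Longrightarrow> \<exists>q\<in>pairs_in T. t q = p"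
    by metis
  define T where "T i = (G ^^ i) T\<^sub>0" for i
  have L: "L (T i)" for i
    using assms G(1) by (induction i) (auto simp: T_def L_def)
  \<comment> \<open>Going from level \<open>i + 1\<close> to level \<open>i\<close> takes a preimage
    of a moved pair, which is again moved and has one step more.\<close>
  have descend: "\<exists>q\<in>pairs_in T\<^sub>0. t q \<noteq> q \<and> steps t q = steps t p + i"
    if "p \<in> pairs_in (T i)" "t p \<noteq> p" for i p
    using that
  proof (induction i arbitrary: p)
    case 0
    then show ?case
      unfolding T_def by auto
  next
    case (Suc i)
    have "p \<in> pairs_in (G (T i))"
      using Suc.prems(1) unfolding T_def by simp
    then obtain q where q: "q \<in> pairs_in (T i)" "t q = p"
      using G(2)[OF L] by blast
    have "steps t q = Suc (steps t p)"
      using steps_preimage q Suc.prems(2) unfolding pairs_in_def by blast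
    moreover have "t q \<noteq> q"
      using q(2) Suc.prems(2) by metis
    ultimately show ?case
      using Suc.IH[OF q(1)] by simp
  qed
  obtain S where S: "S \<subseteq> Field \<kappa>" "|S| =o \<kappa>"
      "\<forall>p\<in>pairs_in S. \<forall>i\<le>n. \<exists>q\<in>pairs_in (T i). t q = p"
    by (rule t_common_value[of n T, OF L[unfolded L_def]])
  \<comment> \<open>This one \<open>p\<close> has a preimage in every level up to \<open>n\<close>;
    the bound \<open>v\<close> becomes \<open>Suc (steps t p)\<close>, the count of those
    preimages.\<close>
  obtain p where p: "p \<in> pairs_in S" "t p \<noteq> p"
    using t_not_fixed[OF S(1,2)] by blast
  show thesis
  proof (rule that, intro allI impI)
    fix i assume "i \<le> n"
    then obtain q where q: "q \<in> pairs_in (T i)" "t q = p"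
      using S(3) p(1) by blast
    have "steps t q = Suc (steps t p)"
      using steps_preimage q p(2) unfolding pairs_in_def by blast
    moreover have "t q \<noteq> q"
      using q(2) p(2) by metis
    ultimately show "\<exists>q\<in>pairs_in T\<^sub>0. t q \<noteq> q \<and> steps t q = Suc (steps t p) + i"
      using descend[OF q(1)] by simp
  qed
qed

lemma strong_colouring:
  assumes A: "|A| =o \<kappa>" "\<And>a. a \<in> A \<Longrightarrow> finite a \<and> a \<subseteq> Field \<kappa>" "pairwise disjnt A" and "j \<le> n"
  shows "\<exists>a\<in>A. \<exists>b\<in>A. a \<noteq> {} \<and> b \<noteq> {} \<and> ord_set_less \<kappa> a b \<and>
    (\<forall>p\<in>a \<times> b. steps t p mod (n + 1) = j)"
proof -
  obtain S where S: "S \<subseteq> Field \<kappa>" "|S| =o \<kappa>"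
    "\<forall>p\<in>pairs_in S. \<exists>a\<in>A. \<exists>b\<in>A. ord_set_less \<kappa> a b \<and> t ` (a \<times> b) = {p}"
    by (rule t_family[OF A])
  obtain v where v: "\<forall>i\<le>n. \<exists>q\<in>pairs_in S. t q \<noteq> q \<and> steps t q = v + i"
    by (rule consecutive_steps[OF S(1,2), of n])
  \<comment> \<open>The shift is by \<open>Suc v\<close> because pairs in
    \<open>a \<times> b\<close> lie one step above the pair \<open>q\<close> they are mapped
    to.\<close>
  obtain i where i: "i \<le> n" "(Suc v + i) mod (n + 1) = j"
    using mod_shift_exists[OF \<open>j \<le> n\<close>] by blast
  obtain q where q: "q \<in> pairs_in S" "t q \<noteq> q" "steps t q = v + i"
    using v i(1) by blast
  obtain a b where ab: "a \<in> A" "b \<in> A" "ord_set_less \<kappa> a b" "t ` (a \<times> b) = {q}"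
    using S(3) q(1) by blast
  have "steps t p mod (n + 1) = j" if p: "p \<in> a \<times> b" for p
  proof -
    have "p \<in> ord_pairs \<kappa>" "t p = q"
      using p ab(3,4) unfolding ord_set_less_def ord_pairs_def by auto
    then have "steps t p = Suc v + i"
      using steps_preimage q by simp
    then show ?thesis
      using i(2) by simp
  qed
  moreover have "a \<noteq> {}" "b \<noteq> {}"
    using ab(4) by auto
  ultimately show ?thesis
    using ab(1-3) by blast
qed

end

section \<open>The poset and its powers\<close>

lemma partial_order_superset: "partial_order_on P {(p, q). p \<in> P \<and> q \<in> P \<and> q \<subseteq> p}"
  unfolding order_on_defs refl_on_def trans_def antisym_def by blast

text \<open>The tag \<open>e i\<close> marks membership in the \<open>i\<close>-th summand of the poset.\<close>

locale tagged_colouring = regular_uncountable +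
  fixes n :: nat and c :: "'a \<times> 'a \<Rightarrow> nat" and e :: "nat \<Rightarrow> 'a"
  assumes c_strong: "|A| =o \<kappa> \<Longrightarrow> (\<And>a. a \<in> A \<Longrightarrow> finite a \<and> a \<subseteq> Field \<kappa>) \<Longrightarrow> pairwise disjnt A \<Longrightarrow>
      j \<le> n \<Longrightarrow> \<exists>a\<in>A. \<exists>b\<in>A. a \<noteq> {} \<and> b \<noteq> {} \<and> ord_set_less \<kappa> a b \<and> (\<forall>p\<in>a \<times> b. c p = j)"
    and c_bound: "c p \<le> n"
    and inj_e: "inj_on e {..n}"
    and e_Field: "e ` {..n} \<subseteq> Field \<kappa>"
begin

text \<open>Tags are elements of the field itself, so the disjoint sum of posets lives in the type
  \<open>'a set\<close>; \<open>omits\<close> therefore ignores them.\<close>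

definition tags :: "'a set" where
  "tags = e ` {..n}"

definition omits :: "nat \<Rightarrow> 'a set \<Rightarrow> bool" where
  "omits i x \<longleftrightarrow> (\<forall>p \<in> pairs_in (x - tags). c p \<noteq> i)"

definition P :: "'a set set" where
  "P = {x. finite x \<and> x \<subseteq> Field \<kappa> \<and> (\<exists>i\<le>n. x \<inter> tags = {e i} \<and> omits i x)}"

definition R :: "'a set rel" where
  "R = {(p, q). p \<in> P \<and> q \<in> P \<and> q \<subseteq> p}"

text \<open>As \<open>e\<close> is injective on the indices, one tag in a condition determines its
  summand; a common extension stays in that summand.\<close>

lemma P_tag:
  assumes "x \<in> P" "i \<le> n" "e i \<in> x"
  shows "x \<inter> tags = {e i}" "omits i x"
proof -
  obtain k where k: "k \<le> n" "x \<inter> tags = {e k}" "omits k x"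
    using assms(1) unfolding P_def by blast
  have "e i \<in> x \<inter> tags"
    using assms unfolding tags_def by blast
  then have "k = i"
    using k assms(2) inj_on_eq_iff[OF inj_e, of i k] by auto
  then show "x \<inter> tags = {e i}" "omits i x"
    using k by auto
qed

lemma finite_tags: "finite tags"
  unfolding tags_def by simp

text \<open>The antichain consists of the tuples with \<open>i\<close>-th entry
  \<open>{e i, \<alpha>}\<close>, which contains no pair off the tags. A common lower bound for
  \<alpha> < \<beta> would, at the coordinate \<open>c (\<alpha>, \<beta>)\<close>, contain a pair
  of the very colour omitted there.\<close>

lemma pow_Suc_not_cc: "\<not> chain_cond \<kappa> (pow_set (n + 1) P) (pow_rel (n + 1) P R)"
proof -
  define f where "f \<alpha> = (\<lambda>i\<in>{..<n + 1}. {e i, \<alpha>})" for \<alpha>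
  define I where "I = Field \<kappa> - tags"
  have I: "|I| =o \<kappa>"
    unfolding I_def by (rule large_Diff_finite[OF card_Field finite_tags])
  have f_P: "f \<alpha> \<in> pow_set (n + 1) P" if "\<alpha> \<in> I" for \<alpha>
  proof -
    have "{e i, \<alpha>} \<in> P" if "i \<le> n" for i
    proof -
      have "e i \<in> tags"
        using that unfolding tags_def by blast
      moreover from this have "{e i, \<alpha>} - tags = {\<alpha>}" "{e i, \<alpha>} \<inter> tags = {e i}"
        using \<open>\<alpha> \<in> I\<close> unfolding I_def by auto
      ultimately show ?thesis
        using \<open>\<alpha> \<in> I\<close> e_Field that
        unfolding P_def omits_def pairs_in_def ord_pairs_def ord_less_def I_def by auto
    qed
    then show ?thesis
      unfolding pow_set_def f_def by (auto simp: less_Suc_eq_le)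
  qed
  have incompatible: False
    if lt: "ord_less \<kappa> \<alpha> \<beta>" and I: "\<alpha> \<in> I" "\<beta> \<in> I"
      and h: "(h, f \<alpha>) \<in> pow_rel (n + 1) P R" "(h, f \<beta>) \<in> pow_rel (n + 1) P R" for \<alpha> \<beta> h
  proof -
    define i where "i = c (\<alpha>, \<beta>)"
    have i: "i \<le> n"
      unfolding i_def by (rule c_bound)
    have "(h i, f \<alpha> i) \<in> R" "(h i, f \<beta> i) \<in> R"
      using h i unfolding pow_rel_def by auto
    then have hi: "h i \<in> P" "{e i, \<alpha>, \<beta>} \<subseteq> h i"
      using i unfolding R_def f_def by auto
    then have "omits i (h i)"
      using P_tag(2) i by blast
    moreover have "(\<alpha>, \<beta>) \<in> pairs_in (h i - tags)"
      using hi I lt unfolding pairs_in_def ord_pairs_def I_def by auto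
    ultimately show False
      unfolding omits_def i_def by blast
  qed
  have "antichain_in (pow_set (n + 1) P) (pow_rel (n + 1) P R) (f ` I)"
    unfolding antichain_in_def
  proof
    show "f ` I \<subseteq> pow_set (n + 1) P"
      using f_P by blast
    show "pairwise (\<lambda>p q. \<not> compatible_in (pow_set (n + 1) P) (pow_rel (n + 1) P R) p q) (f ` I)"
    proof (rule pairwiseI, rule notI)
      fix p q
      assume pq: "p \<in> f ` I" "q \<in> f ` I" "p \<noteq> q"
        and "compatible_in (pow_set (n + 1) P) (pow_rel (n + 1) P R) p q"
      then obtain h where "(h, p) \<in> pow_rel (n + 1) P R" "(h, q) \<in> pow_rel (n + 1) P R"
        unfolding compatible_in_def by blast
      moreover obtain \<alpha> \<beta> where ab: "\<alpha> \<in> I" "\<beta> \<in> I" "p = f \<alpha>" "q = f \<beta>" "\<alpha> \<noteq> \<beta>"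
        using pq by blast
      moreover have "ord_less \<kappa> \<alpha> \<beta> \<or> ord_less \<kappa> \<beta> \<alpha>"
        using ab ord_less_total unfolding I_def by blast
      ultimately show False
        using incompatible by blast
    qed
  qed
  moreover have "inj_on f I"
  proof (rule inj_onI)
    fix \<alpha> \<beta> assume ab: "\<alpha> \<in> I" "\<beta> \<in> I" "f \<alpha> = f \<beta>"
    have "f \<alpha> 0 = f \<beta> 0"
      using ab(3) by simp
    moreover have "e 0 \<in> tags"
      unfolding tags_def by blast
    ultimately show "\<alpha> = \<beta>"
      using ab unfolding f_def I_def by (auto simp: doubleton_eq_iff)
  qed
  ultimately show ?thesis
    using large_bij_image[OF I, of f] unfolding chain_cond_def by auto
qed

text \<open>The amalgamation step: outside the common trace on \<open>r\<close>, the new pairs all lie in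
  \<open>(x - r) \<times> (y - r)\<close>.\<close>

lemma union_in_P:
  assumes x: "x \<in> P" and y: "y \<in> P" and i: "i \<le> n" "e i \<in> x"
    and trace: "x \<inter> r = y \<inter> r" "tags \<subseteq> r"
    and less: "ord_set_less \<kappa> (x - r) (y - r)"
    and colour: "\<And>p. p \<in> (x - r) \<times> (y - r) \<Longrightarrow> c p \<noteq> i"
  shows "x \<union> y \<in> P"
proof -
  have "e i \<in> tags"
    using i unfolding tags_def by blast
  then have "e i \<in> y"
    using trace i by blast
  note x_tag = P_tag[OF x i] and y_tag = P_tag[OF y i(1) this]
  have "omits i (x \<union> y)"
    unfolding omits_def
  proof
    fix p assume p: "p \<in> pairs_in (x \<union> y - tags)"
    obtain \<alpha> \<beta> where ab: "p = (\<alpha>, \<beta>)"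
      by fastforce
    \<comment> \<open>Points of the common trace belong to both sets, so a pair inside neither
      \<open>x\<close> nor \<open>y\<close> has one point in \<open>x - r\<close> and the other in
      \<open>y - r\<close>; the last case is the wrong order.\<close>
    consider "p \<in> pairs_in (x - tags)" | "p \<in> pairs_in (y - tags)"
      | "p \<in> (x - r) \<times> (y - r)" | "\<alpha> \<in> y - r" "\<beta> \<in> x - r"
      using p trace unfolding pairs_in_def ab by blast
    then show "c p \<noteq> i"
    proof cases
      case 4
      then have "ord_less \<kappa> \<beta> \<alpha>"
        using less unfolding ord_set_less_def by blast
      moreover have "ord_less \<kappa> \<alpha> \<beta>"
        using p unfolding ab pairs_in_def ord_pairs_def by blast
      ultimately show ?thesis
        using ord_less_asym by blast
    qed (use x_tag(2) y_tag(2) colour in \<open>auto simp: omits_def\<close>)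
  qed
  moreover have "(x \<union> y) \<inter> tags = {e i}"
    using x_tag(1) y_tag(1) by blast
  ultimately show ?thesis
    using x y i(1) unfolding P_def by blast
qed

text \<open>Thin out a supposed large antichain to a Delta-system with equal traces on the root,
  then colour the parts off the root by a \<open>j\<close> that tags no coordinate; the
  coordinatewise union of the two tuples found is a condition.\<close>

lemma pow_cc: "chain_cond \<kappa> (pow_set n P) (pow_rel n P R)"
  unfolding chain_cond_def
proof
  assume "\<exists>X. antichain_in (pow_set n P) (pow_rel n P R) X \<and> |X| =o \<kappa>"
  then obtain X where X: "antichain_in (pow_set n P) (pow_rel n P R) X" "|X| =o \<kappa>"
    by blast
  define F where "F f = (\<Union>i<n. f i)" for f :: "nat \<Rightarrow> 'a set"
  have Xpow: "X \<subseteq> pow_set n P"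
    using X(1) unfolding antichain_in_def by (rule conjunct1)
  have XP: "f i \<in> P" if "f \<in> X" "i < n" for f i
    using subsetD[OF Xpow that(1)] that(2) by (auto simp: pow_set_def PiE_iff)
  have Xext: "f \<in> extensional {..<n}" if "f \<in> X" for f
    using subsetD[OF Xpow that] by (simp add: pow_set_def PiE_iff)
  have finF: "finite (F f)" "F f \<subseteq> Field \<kappa>" if "f \<in> X" for f
    using XP[OF that] unfolding F_def P_def by auto
  obtain Y r\<^sub>0 where Y: "Y \<subseteq> X" "|Y| =o \<kappa>" "finite r\<^sub>0"
      "\<forall>f\<in>Y. \<forall>g\<in>Y. f \<noteq> g \<longrightarrow> F f \<inter> F g \<subseteq> r\<^sub>0"
    by (rule delta_system[OF X(2) finF(1)])
  \<comment> \<open>With the tags in the root, the trace also fixes the summand of each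
    coordinate.\<close>
  define r where "r = r\<^sub>0 \<union> tags"
  define trace where "trace f = (\<lambda>i\<in>{..<n}. f i \<inter> r)" for f :: "nat \<Rightarrow> 'a set"
  have r: "finite r" "tags \<subseteq> r"
    using Y(3) finite_tags unfolding r_def by auto
  have "finite (trace ` Y)"
  proof (rule finite_subset)
    show "trace ` Y \<subseteq> {..<n} \<rightarrow>\<^sub>E Pow r"
      unfolding trace_def by auto
    show "finite ({..<n} \<rightarrow>\<^sub>E Pow r)"
      using r(1) by (intro finite_PiE) auto
  qed
  then obtain \<tau> where \<tau>: "|{f\<in>Y. trace f = \<tau>}| =o \<kappa>"
    using large_pigeonhole[OF Y(2), of trace] finite_small by metis
  define Z where "Z = {f\<in>Y. trace f = \<tau>}"
  have ZY: "f \<in> Y" "f \<in> X" if "f \<in> Z" for f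
    using that Y(1) unfolding Z_def by auto
  have ZI: "f i \<inter> r = g i \<inter> r" if "f \<in> Z" "g \<in> Z" "i < n" for f g i
  proof -
    have "trace f i = trace g i"
      using that unfolding Z_def by simp
    then show ?thesis
      using that(3) unfolding trace_def by simp
  qed
  define d where "d f = F f - r" for f
  have d_disj: "d f \<inter> d g = {}" if "f \<in> Z" "g \<in> Z" "f \<noteq> g" for f g
  proof -
    have "F f \<inter> F g \<subseteq> r\<^sub>0"
      using Y(4) ZY(1) that by blast
    then show ?thesis
      unfolding d_def r_def by blast
  qed
  \<comment> \<open>Distinct tuples with equal \<open>d\<close> would both have empty
    \<open>d\<close>, hence coincide with their common trace.\<close>
  have "inj_on d Z"
  proof (rule inj_onI, rule ccontr)
    fix f g assume fg: "f \<in> Z" "g \<in> Z" "d f = d g" "f \<noteq> g"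
    then have "d f = {}" "d g = {}"
      using d_disj by blast+
    then have "f i = g i" if "i < n" for i
      using ZI[OF fg(1,2) that] that unfolding d_def F_def by blast
    then have "f = g"
      using Xext ZY(2) fg(1,2) by (intro extensionalityI[of f "{..<n}" g]) auto
    then show False
      using fg(4) by blast
  qed
  then have "|d ` Z| =o \<kappa>"
    using large_bij_image[of Z d] \<tau> unfolding Z_def by simp
  moreover have "pairwise disjnt (d ` Z)"
    using d_disj by (simp add: pairwise_image pairwise_def disjnt_def) metis
  moreover have "finite a \<and> a \<subseteq> Field \<kappa>" if "a \<in> d ` Z" for a
    using that finF ZY(2) unfolding d_def by blast
  \<comment> \<open>The \<open>n\<close> coordinates carry at most \<open>n\<close> of the
    \<open>n + 1\<close> tags, and the choice is the same throughout \<open>Z\<close> as it depends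
    on the trace alone.\<close>
  moreover obtain j where j: "j \<le> n" "\<And>i. i < n \<Longrightarrow> e j \<notin> \<tau> i"
  proof -
    obtain f where f: "f \<in> Z"
      using large_infinite[OF \<tau>] unfolding Z_def[symmetric] by fastforce
    have "\<exists>k\<le>n. f i \<inter> tags = {e k}" if "i < n" for i
      using XP[OF ZY(2)[OF f] that] unfolding P_def by blast
    then obtain k where k: "\<And>i. i < n \<Longrightarrow> f i \<inter> tags = {e (k i)} \<and> k i \<le> n"
      by metis
    have "card (k ` {..<n}) < card {..n}"
      using card_image_le[of "{..<n}" k] by simp
    then have "\<not> {..n} \<subseteq> k ` {..<n}"
      using card_mono[of "k ` {..<n}" "{..n}"] by auto
    then obtain j where j: "j \<le> n" "j \<notin> k ` {..<n}"
      by auto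
    have "e j \<notin> \<tau> i" if "i < n" for i
    proof
      assume "e j \<in> \<tau> i"
      moreover have "\<tau> i = f i \<inter> r"
        using f that unfolding Z_def trace_def by auto
      ultimately have "e j \<in> f i \<inter> tags"
        using j(1) unfolding tags_def by blast
      then have "e j = e (k i)"
        using k that by blast
      then have "j = k i"
        using inj_on_eq_iff[OF inj_e] j(1) k that by auto
      then show False
        using j(2) that by blast
    qed
    then show thesis
      using that j(1) by blast
  qed
  ultimately obtain a b where ab: "a \<in> d ` Z" "b \<in> d ` Z" "a \<noteq> {}" "b \<noteq> {}"
      "ord_set_less \<kappa> a b" "\<forall>p\<in>a \<times> b. c p = j"
    using c_strong[of "d ` Z" j] by blast
  then obtain f g where fg: "f \<in> Z" "g \<in> Z" "a = d f" "b = d g"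
    by blast
  have "f \<noteq> g"
    using ab fg unfolding ord_set_less_def ord_less_def by blast
  define h where "h = (\<lambda>i\<in>{..<n}. f i \<union> g i)"
  have hP: "f i \<union> g i \<in> P" if i: "i < n" for i
  proof -
    have fP: "f i \<in> P" and gP: "g i \<in> P"
      using XP ZY(2) fg i by auto
    obtain k where k: "k \<le> n" "f i \<inter> tags = {e k}"
      using fP unfolding P_def by blast
    have "e k \<in> f i \<inter> r"
      using k(2) r(2) by blast
    then have "e k \<in> \<tau> i"
      using fg(1) i unfolding Z_def trace_def by auto
    \<comment> \<open>So new pairs, all of colour \<open>j\<close>, do not violate the colour
      \<open>k\<close> that this coordinate must omit.\<close>
    then have "k \<noteq> j"
      using j(2)[OF i] by blast
    have sub: "f i - r \<subseteq> a" "g i - r \<subseteq> b"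
      using i unfolding fg(3,4) d_def F_def by auto
    show ?thesis
    proof (rule union_in_P[OF fP gP k(1)])
      show "e k \<in> f i"
        using k by blast
      show "f i \<inter> r = g i \<inter> r" "tags \<subseteq> r"
        by (rule ZI[OF fg(1,2) i]) (rule r(2))
      show "ord_set_less \<kappa> (f i - r) (g i - r)"
        using ab(5) sub unfolding ord_set_less_def by blast
      show "c p \<noteq> k" if "p \<in> (f i - r) \<times> (g i - r)" for p
        using that sub ab(6) \<open>k \<noteq> j\<close> by blast
    qed
  qed
  then have h: "h \<in> pow_set n P"
    unfolding pow_set_def h_def by auto
  have "(h, k) \<in> pow_rel n P R" if k: "k \<in> Z" "\<And>i. k i \<subseteq> f i \<union> g i" for k
    using h subsetD[OF Xpow ZY(2)[OF k(1)]] XP[OF ZY(2)[OF k(1)]] hP k(2)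
    by (simp add: pow_rel_def R_def h_def)
  then have "(h, f) \<in> pow_rel n P R" "(h, g) \<in> pow_rel n P R"
    using fg(1,2) by auto
  with h have "compatible_in (pow_set n P) (pow_rel n P R) f g"
    unfolding compatible_in_def by blast
  then show False
    using X(1) ZY(2)[OF fg(1)] ZY(2)[OF fg(2)] \<open>f \<noteq> g\<close>
    unfolding antichain_in_def pairwise_def by blast
qed

end

theorem theoremB:
  fixes \<kappa> :: "'a rel"
  assumes "Card_order \<kappa>" and "natLeq <o \<kappa>" and "regularCard \<kappa>"
    and "Pl1 \<kappa>"
  shows "\<forall>n\<ge>1. \<exists>(P :: 'a set set) R. partial_order_on P R \<and>
           chain_cond \<kappa> (pow_set n P) (pow_rel n P R) \<and>
           \<not> chain_cond \<kappa> (pow_set (n + 1) P) (pow_rel (n + 1) P R)"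
proof (intro allI impI)
  fix n :: nat
  interpret regular_uncountable \<kappa>
    using assms(1-3) by unfold_locales
  obtain t where t: "t \<in> ord_pairs \<kappa> \<rightarrow> ord_pairs \<kappa>"
    "\<forall>(\<alpha>, \<beta>) \<in> ord_pairs \<kappa>. \<forall>\<alpha>' \<beta>'. t (\<alpha>, \<beta>) = (\<alpha>', \<beta>') \<longrightarrow>
        (\<alpha>', \<alpha>) \<in> \<kappa> \<and> ord_less \<kappa> \<alpha> \<beta>' \<and> (\<beta>', \<beta>) \<in> \<kappa>"
    "\<forall>A. |A| =o \<kappa> \<and> (\<forall>a\<in>A. finite a \<and> a \<subseteq> Field \<kappa>) \<and> pairwise disjnt A \<longrightarrow>
        (\<exists>S. stationary_in \<kappa> S \<and>
           (\<forall>\<alpha>'\<in>S. \<forall>\<beta>'\<in>S. ord_less \<kappa> \<alpha>' \<beta>' \<longrightarrow>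
              (\<exists>a\<in>A. \<exists>b\<in>A. ord_set_less \<kappa> a b \<and> t ` (a \<times> b) = {(\<alpha>', \<beta>')})))"
    using assms(4) unfolding Pl1_def by (elim bexE conjE)
  interpret transformation \<kappa> t
  proof
    show "t p \<in> ord_pairs \<kappa>" if "p \<in> ord_pairs \<kappa>" for p
      using t(1) that by blast
    show "(fst (t (\<alpha>, \<beta>)), \<alpha>) \<in> \<kappa>" "(snd (t (\<alpha>, \<beta>)), \<beta>) \<in> \<kappa>" if "(\<alpha>, \<beta>) \<in> ord_pairs \<kappa>" for \<alpha> \<beta>
      using bspec[OF t(2) that] by (cases "t (\<alpha>, \<beta>)"; simp)+
  qed (use t(3) in blast)
  \<comment> \<open>The first \<open>n + 1\<close> values of \<open>e\<close> become the
    tags.\<close>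
  obtain e :: "nat \<Rightarrow> 'a" where e: "inj e" "range e \<subseteq> Field \<kappa>"
    using infinite_Field infinite_countable_subset by blast
  interpret tagged_colouring \<kappa> n "\<lambda>p. steps t p mod (n + 1)" e
  proof
    show "steps t p mod (n + 1) \<le> n" for p
      using mod_less_divisor[of "n + 1" "steps t p"] by simp
    show "inj_on e {..n}" "e ` {..n} \<subseteq> Field \<kappa>"
      using e by (auto intro: inj_on_subset)
  qed (rule strong_colouring)
  show "\<exists>(P :: 'a set set) R. partial_order_on P R \<and>
           chain_cond \<kappa> (pow_set n P) (pow_rel n P R) \<and>
           \<not> chain_cond \<kappa> (pow_set (n + 1) P) (pow_rel (n + 1) P R)"
    using partial_order_superset[of P] pow_cc pow_Suc_not_cc unfolding R_def by blast
qed

end
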